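(* Let $N$ be an odd positive integer such that $\sigma^*(\sigma^*(N))=2N$. Then $N=9$ or $N=165$.
   Context: For a positive integer $n$, a divisor $d$ of $n$ is called a unitary divisor if $\gcd(d,n/d)=1$, and $\sigma^*(n)$ denotes the sum of all unitary divisors of $n$. An integer $N$ with $\sigma^*(\sigma^*(N))=2N$ is called a unitary super perfect (USP) number. *)

theory Defs
  imports "HOL-Number_Theory.Number_Theory"
begin

definition unitary_divisor :: "nat \<Rightarrow> nat \<Rightarrow> bool" where
  "unitary_divisor d n \<longleftrightarrow> d dvd n \<and> gcd d (n div d) = 1"

definition unitary_sigma :: "nat \<Rightarrow> nat" where
  "unitary_sigma n = (\<Sum>d | unitary_divisor d n. d)"

end

theory Submission
  imports Defs "HOL-Analysis.Infinite_Products"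
begin

text \<open>
  Write \<open>\<sigma>\<close> for the unitary divisor sum. As \<open>\<sigma> (\<sigma> N) = 2 N\<close> is not divisible by 4, \<open>\<sigma> N = 2^e q^f\<close> for one
  odd prime \<open>q\<close>, so that \<open>2 N = (2^e + 1) (q^f + 1)\<close>, and every prime power \<open>p^a\<close> exactly dividing \<open>N\<close>
  satisfies \<open>p^a + 1 = 2^i q^j\<close>, where the pairs \<open>(i, j)\<close> are distinct and sum up to \<open>(e, f)\<close>.
  Since \<open>p\<close> divides \<open>2^e + 1\<close> or \<open>q^f + 1\<close>, quadratic residues force \<open>i \<le> 2\<close> whenever \<open>j > 0\<close>
  or \<open>f\<close> is even. Comparing \<open>\<sigma> N / N\<close> with \<open>\<sigma> (\<sigma> N) / \<sigma> N\<close> gives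
  \<open>2 \<Prod> (1 - 1 / (2^i q^j)) = (1 + 1 / 2^e) (1 + 1 / q^f)\<close>;
  with the few pairs available (Mersenne primes for \<open>j = 0\<close>) the left-hand side is too large unless \<open>N = 9\<close> or \<open>q = 3\<close>, and
  for \<open>q = 3\<close> it forces the prime powers 3, 5, 11 and then \<open>f = 2\<close>.
\<close>

section \<open>Unitary divisors and the product formula for their sum\<close>

lemma unitary_divisor_iff_subproduct:
  fixes n :: nat
  assumes "n > 0"
  shows "unitary_divisor d n \<longleftrightarrow> (\<exists>A\<subseteq>prime_factors n. d = (\<Prod>p\<in>A. p ^ multiplicity p n))"
proof
  assume "unitary_divisor d n"
  then have "d dvd n" "coprime d (n div d)"
    unfolding unitary_divisor_def coprime_iff_gcd_eq_1 by blast+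
  then obtain c where n: "n = d * c" and "coprime d c" using \<open>n > 0\<close> by auto
  have "d > 0" "c > 0" using n \<open>n > 0\<close> by auto
  \<comment> \<open>A prime of \<open>d\<close> does not divide the coprime cofactor
    \<open>c\<close>, so its whole exponent in \<open>n\<close> lies in \<open>d\<close>.\<close>
  have "multiplicity p d = multiplicity p n" if "p \<in> prime_factors d" for p
  proof -
    have "\<not> p dvd c"
      using that \<open>coprime d c\<close> by (auto simp: in_prime_factors_iff dest: coprime_common_divisor)
    then show ?thesis
      using that n \<open>d > 0\<close> \<open>c > 0\<close>
      by (simp add: in_prime_factors_iff prime_elem_multiplicity_mult_distrib not_dvd_imp_multiplicity_0)
  qed
  then have "d = (\<Prod>p\<in>prime_factors d. p ^ multiplicity p n)"
    using prime_factorization_nat[OF \<open>d > 0\<close>] by simp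
  moreover have "prime_factors d \<subseteq> prime_factors n"
    using n \<open>n > 0\<close> by (simp add: dvd_prime_factors)
  ultimately show "\<exists>A\<subseteq>prime_factors n. d = (\<Prod>p\<in>A. p ^ multiplicity p n)" by blast
next
  assume "\<exists>A\<subseteq>prime_factors n. d = (\<Prod>p\<in>A. p ^ multiplicity p n)"
  then obtain A where A: "A \<subseteq> prime_factors n" and d: "d = (\<Prod>p\<in>A. p ^ multiplicity p n)" by blast
  define c where "c = (\<Prod>p\<in>prime_factors n - A. p ^ multiplicity p n)"
  have "n = c * d"
    unfolding c_def d using A prime_factorization_nat[OF \<open>n > 0\<close>]
    by (metis prod.subset_diff finite_set_mset)
  moreover have "coprime d c"
    unfolding c_def d using A
    by (intro prod_coprime_left prod_coprime_right)
       (auto intro!: primes_coprime simp: in_prime_factors_iff)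
  ultimately show "unitary_divisor d n"
    using \<open>n > 0\<close> unfolding unitary_divisor_def coprime_iff_gcd_eq_1 by auto
qed

text \<open>Since all exponents are positive, \<open>A\<close> is recovered from the product as the
  set of primes in \<open>P\<close> with positive multiplicity.\<close>

lemma inj_on_subproduct:
  fixes f :: "nat \<Rightarrow> nat"
  assumes "finite P" "\<And>p. p \<in> P \<Longrightarrow> prime p" "\<And>p. p \<in> P \<Longrightarrow> f p > 0"
  shows "inj_on (\<lambda>A. \<Prod>p\<in>A. p ^ f p) (Pow P)"
proof (rule inj_on_inverseI)
  fix A assume "A \<in> Pow P"
  then have "finite A" "A \<subseteq> P" using assms(1) finite_subset by auto
  then have "multiplicity p (\<Prod>p\<in>A. p ^ f p) = (if p \<in> A then f p else 0)" if "prime p" for p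
    using that assms by (intro multiplicity_prod_prime_powers) auto
  then show "{p \<in> P. multiplicity p (\<Prod>p\<in>A. p ^ f p) > 0} = A"
    using assms \<open>A \<subseteq> P\<close> by (auto split: if_splits)
qed

text \<open>The unitary divisors are the distinct subproducts of the prime power components, and
  their sum is the expansion of the product of the factors
  \<open>p ^ multiplicity p n + 1\<close>.\<close>

lemma unitary_sigma_eq_prod:
  assumes "n > 0"
  shows "unitary_sigma n = (\<Prod>p\<in>prime_factors n. p ^ multiplicity p n + 1)"
proof -
  let ?g = "\<lambda>A. \<Prod>p\<in>A. p ^ multiplicity p n"
  have "{d. unitary_divisor d n} = ?g ` Pow (prime_factors n)"
    using unitary_divisor_iff_subproduct[OF assms] by auto
  moreover have "inj_on ?g (Pow (prime_factors n))"
  proof (rule inj_on_subproduct)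
    show "multiplicity p n > 0" if "p \<in> prime_factors n" for p
      using that by (simp add: prime_factors_multiplicity)
  qed auto
  ultimately have "unitary_sigma n = (\<Sum>A\<in>Pow (prime_factors n). ?g A)"
    by (simp add: unitary_sigma_def sum.reindex)
  then show ?thesis by (subst prod_add) simp_all
qed

section \<open>The shape of \<open>unitary_sigma N\<close> for an odd unitary super perfect
  \<open>N\<close>\<close>

lemma dvd_two_prime_powersE:
  fixes p q :: nat
  assumes "prime p" "prime q" "d dvd p ^ e * q ^ f"
  obtains i j where "d = p ^ i * q ^ j"
proof -
  obtain x y where "d = x * y" "x dvd p ^ e" "y dvd q ^ f" using dvd_productE assms(3) by blast
  then show thesis using that assms by (auto simp: divides_primepow_nat)
qed

lemma two_prime_powers_eq_iff:
  fixes p q :: nat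
  assumes "prime p" "prime q" "p \<noteq> q"
  shows "p ^ i * q ^ j = p ^ e * q ^ f \<longleftrightarrow> i = e \<and> j = f"
proof
  assume eq: "p ^ i * q ^ j = p ^ e * q ^ f"
  have m: "multiplicity p (p ^ a * q ^ b) = a" "multiplicity q (p ^ a * q ^ b) = b" for a b
    using assms
    by (auto simp: prime_elem_multiplicity_mult_distrib multiplicity_distinct_prime_power
        not_dvd_imp_multiplicity_0 prime_gt_0_nat prime_dvd_power_iff primes_dvd_imp_eq)
  show "i = e \<and> j = f" using m eq by metis
qed simp

text \<open>Each odd prime contributes an even factor to the product formula, so two of them would
  already give a factor 4.\<close>

lemma odd_prime_factors_of_unitary_sigma_2_mod_4:
  assumes "n > 0" "\<not> 4 dvd unitary_sigma n" "p \<in> prime_factors n" "q \<in> prime_factors n" "odd p" "odd q"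
  shows "p = q"
proof (rule ccontr)
  assume "p \<noteq> q"
  have "2 * 2 dvd (p ^ multiplicity p n + 1) * (q ^ multiplicity q n + 1)"
    using assms by (intro mult_dvd_mono) auto
  also have "\<dots> = (\<Prod>p\<in>{p, q}. p ^ multiplicity p n + 1)" using \<open>p \<noteq> q\<close> by simp
  also have "\<dots> dvd unitary_sigma n"
    unfolding unitary_sigma_eq_prod[OF assms(1)] using assms by (intro prod_dvd_prod_subset) auto
  finally show False using assms by simp
qed

lemma odd_usp_structure:
  assumes "N > 0" "odd N" and usp: "unitary_sigma (unitary_sigma N) = 2 * N"
  obtains q e f and i j :: "nat \<Rightarrow> nat" where "prime q" "odd q" "f > 0" "2 * N = (2 ^ e + 1) * (q ^ f + 1)"
    "\<And>p. p \<in> prime_factors N \<Longrightarrow> p ^ multiplicity p N + 1 = 2 ^ i p * q ^ j p"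
    "(\<Sum>p\<in>prime_factors N. i p) = e" "(\<Sum>p\<in>prime_factors N. j p) = f"
proof -
  define M where "M = unitary_sigma N"
  have M: "M = (\<Prod>p\<in>prime_factors N. p ^ multiplicity p N + 1)"
    unfolding M_def by (rule unitary_sigma_eq_prod) fact
  have "M > 0" unfolding M by (auto intro!: prod_pos)
  have sM: "2 * N = (\<Prod>p\<in>prime_factors M. p ^ multiplicity p M + 1)"
    using unitary_sigma_eq_prod[OF \<open>M > 0\<close>] usp by (simp add: M_def)
  have "\<not> 4 dvd 2 * N" using \<open>odd N\<close> by presburger
  then have unique: "p = p'" if "p \<in> prime_factors M" "p' \<in> prime_factors M" "odd p" "odd p'" for p p'
    using odd_prime_factors_of_unitary_sigma_2_mod_4 \<open>M > 0\<close> that usp M_def by metis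
  have "N \<noteq> 1"
  proof
    assume "N = 1"
    then have "M = 1" using M by simp
    then show False using sM \<open>N = 1\<close> by simp
  qed
  then obtain p where p: "p \<in> prime_factors N"
    using \<open>N > 0\<close> prime_factor_nat by (metis in_prime_factors_iff neq0_conv)
  then have "odd p" using \<open>odd N\<close> by (auto simp: in_prime_factors_iff)
  have "p ^ multiplicity p N + 1 dvd M" unfolding M using p by (intro dvd_prodI) auto
  then have "even M" using \<open>odd p\<close> by (meson dvd_trans even_plus_one_iff even_power)
  then have two: "2 \<in> prime_factors M" using \<open>M > 0\<close> by (auto simp: in_prime_factors_iff)
  \<comment> \<open>If \<open>M\<close> were a power of 2, then its unitary divisor sum
    \<open>2 * N\<close> would be one more than a positive power of 2, hence odd.\<close>
  have "\<exists>q\<in>prime_factors M. odd q"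
  proof (rule ccontr)
    assume "\<not> ?thesis"
    then have "p = 2" if "p \<in> prime_factors M" for p
      using that primes_dvd_imp_eq[of 2 p] by (auto simp: in_prime_factors_iff)
    then have "prime_factors M = {2}" using two by blast
    then have "2 * N = 2 ^ multiplicity 2 M + 1" using sM by simp
    moreover have "multiplicity 2 M > 0" using two by (simp add: prime_factors_multiplicity)
    ultimately show False by (metis dvd_triv_left even_plus_one_iff even_power even_numeral)
  qed
  then obtain q where q: "q \<in> prime_factors M" "odd q" by blast
  then have "prime q" by auto
  have pf: "prime_factors M = {2, q}"
  proof -
    have "p = 2" if "p \<in> prime_factors M" "even p" for p
      using that primes_dvd_imp_eq[of 2 p] by (auto simp: in_prime_factors_iff)
    then show ?thesis using unique[OF _ q(1) _ q(2)] q two by blast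
  qed
  define e f where "e = multiplicity 2 M" and "f = multiplicity q M"
  have "q \<noteq> 2" using q by auto
  have "M = 2 ^ e * q ^ f"
    using prime_factorization_nat[OF \<open>M > 0\<close>] \<open>q \<noteq> 2\<close> unfolding pf by (simp add: e_def f_def)
  have "2 * N = (2 ^ e + 1) * (q ^ f + 1)" using sM \<open>q \<noteq> 2\<close> unfolding pf by (simp add: e_def f_def)
  have "f > 0" using q(1) by (simp add: prime_factors_multiplicity f_def)
  have "\<exists>i j. p ^ multiplicity p N + 1 = 2 ^ i * q ^ j" if "p \<in> prime_factors N" for p
  proof -
    have "p ^ multiplicity p N + 1 dvd 2 ^ e * q ^ f"
      unfolding \<open>M = 2 ^ e * q ^ f\<close>[symmetric] M using that by (intro dvd_prodI) auto
    then show ?thesis by (metis dvd_two_prime_powersE two_is_prime_nat \<open>prime q\<close>)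
  qed
  then obtain i j where ij: "\<And>p. p \<in> prime_factors N \<Longrightarrow> p ^ multiplicity p N + 1 = 2 ^ i p * q ^ j p"
    by metis
  \<comment> \<open>Multiplying all components gives \<open>M\<close> a second time; unique
    factorization then compares the exponents of 2 and \<open>q\<close>.\<close>
  have "2 ^ (\<Sum>p\<in>prime_factors N. i p) * q ^ (\<Sum>p\<in>prime_factors N. j p) = 2 ^ e * q ^ f"
    unfolding \<open>M = 2 ^ e * q ^ f\<close>[symmetric] M power_sum prod.distrib[symmetric]
    by (intro prod.cong refl ij[symmetric])
  then have "(\<Sum>p\<in>prime_factors N. i p) = e \<and> (\<Sum>p\<in>prime_factors N. j p) = f"
    using two_prime_powers_eq_iff \<open>prime q\<close> \<open>q \<noteq> 2\<close> two_is_prime_nat by metis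
  then show thesis using that \<open>prime q\<close> q(2) \<open>f > 0\<close> \<open>2 * N = (2 ^ e + 1) * (q ^ f + 1)\<close> ij by blast
qed

section \<open>Residue obstructions\<close>

text \<open>Here -1 is a non-residue: with n = 2m and h = (p - 1)/2 odd, raising x^n = -1 to the
  power h gives -1 on the right, but x^(nh) = (x^(p-1))^m = 1 by Fermat.\<close>

lemma not_dvd_even_power_add_1:
  fixes p x :: nat
  assumes "prime p" "p mod 4 = 3" "even n"
  shows "\<not> p dvd x ^ n + 1"
proof
  assume dvd: "p dvd x ^ n + 1"
  define h where "h = (p - 1) div 2"
  have h: "odd h" "p - 1 = 2 * h" using assms(2) unfolding h_def by presburger+
  obtain m where m: "n = 2 * m" using \<open>even n\<close> by blast
  \<comment> \<open>Needed for Fermat's theorem. The exponent 0 is separate because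
    \<open>x ^ 0 + 1 = 2\<close> whatever \<open>x\<close> is.\<close>
  have "\<not> p dvd x"
  proof
    assume "p dvd x"
    show False
    proof (cases "n = 0")
      case True
      then have "p \<le> 2" using dvd by (auto dest: dvd_imp_le)
      then show False using assms(2) prime_ge_2_nat[OF assms(1)] by simp
    next
      case False
      then have "p dvd x ^ n" using \<open>p dvd x\<close> by (metis dvd_power dvd_trans neq0_conv)
      then have "p dvd 1" using dvd by (metis dvd_add_right_iff)
      then show False using assms(1) by simp
    qed
  qed
  then have "[x ^ (p - 1) = 1] (mod p)" using fermat_theorem assms(1) by blast
  then have "[(x ^ (p - 1)) ^ m = 1 ^ m] (mod p)" by (rule cong_pow)
  then have "[int ((x ^ n) ^ h) = int 1] (mod int p)"
    unfolding cong_int_iff using h(2) by (simp add: m mult_ac flip: power_mult)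
  moreover have "[int (x ^ n) = - 1] (mod int p)"
    using dvd unfolding cong_iff_dvd_diff by (metis diff_minus_eq_add int_dvd_int_iff of_nat_1 of_nat_add)
  then have "[int (x ^ n) ^ h = (- 1) ^ h] (mod int p)" by (rule cong_pow)
  ultimately have "[1 = - 1] (mod int p)"
    using h(1) by simp (metis cong_sym cong_trans)
  then have "int p dvd 2" by (simp add: cong_iff_dvd_diff)
  then have "p dvd 2" by presburger
  then have "p \<le> 2" by (rule dvd_imp_le) simp
  then show False using assms(2) prime_ge_2_nat[OF assms(1)] by simp
qed

text \<open>By Euler's criterion x^h = 1 for h = (p - 1)/2, which is odd; raising x^n = -1 to the
  power h would give 1 = -1.\<close>

lemma not_dvd_odd_power_add_1_of_quadratic_residue:
  fixes p x :: nat
  assumes "prime p" "p mod 4 = 3" "Legendre (int x) (int p) = 1" "odd n"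
  shows "\<not> p dvd x ^ n + 1"
proof
  assume dvd: "p dvd x ^ n + 1"
  define h where "h = (p - 1) div 2"
  have h: "odd h" "2 < p" using assms(2) prime_ge_2_nat[OF assms(1)] unfolding h_def by (presburger, simp)
  have "[int x ^ h = 1] (mod int p)"
    using euler_criterion[OF assms(1) h(2), of "int x"] assms(3) by (simp add: h_def cong_sym)
  then have "[(int x ^ h) ^ n = 1 ^ n] (mod int p)" by (rule cong_pow)
  moreover have "[int (x ^ n) = - 1] (mod int p)"
    using dvd unfolding cong_iff_dvd_diff by (metis diff_minus_eq_add int_dvd_int_iff of_nat_1 of_nat_add)
  then have "[int (x ^ n) ^ h = (- 1) ^ h] (mod int p)" by (rule cong_pow)
  ultimately have "[1 = - 1] (mod int p)"
    using h(1) by (simp add: power_mult[symmetric] mult.commute) (metis cong_sym cong_trans)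
  then have "int p dvd 2" by (simp add: cong_iff_dvd_diff)
  then have "p dvd 2" by presburger
  then have "p \<le> 2" by (rule dvd_imp_le) simp
  then show False using assms(2) prime_ge_2_nat[OF assms(1)] by simp
qed

text \<open>Gauss's lemma: for p = 8k + 7 the doubles 2y that exceed (p - 1)/2 = 4k + 3 are those
  with y from 2k + 2 to 4k + 3, and their number 2k + 2 is even.\<close>

lemma Legendre_2_of_7_mod_8:
  fixes p :: nat
  assumes "prime p" "p mod 8 = 7"
  shows "Legendre 2 (int p) = 1"
proof -
  have "2 < p" using assms prime_ge_2_nat[OF assms(1)] by (cases "p = 2") auto
  obtain k where k: "p = 8 * k + 7" using assms(2) by (metis mult_div_mod_eq)
  have "\<not> int p dvd 2"
    using \<open>2 < p\<close> by (auto dest: zdvd_imp_le)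
  then interpret GAUSS p 2
    by unfold_locales (use assms \<open>2 < p\<close> in \<open>auto simp: cong_0_iff\<close>)
  have "E = (\<lambda>y. 2 * y) ` {2 * int k + 2 .. 4 * int k + 3}"
  proof -
    have half: "(int p - 1) div 2 = 4 * int k + 3" using k by simp
    \<comment> \<open>The doubles are at most p - 1, so reduction modulo p changes nothing.\<close>
    have "C = B"
      unfolding C_def B_def A_def half by (auto simp: image_image k intro!: image_cong)
    show ?thesis unfolding E_def \<open>C = B\<close> B_def A_def half by auto
  qed
  then have "card E = card {2 * int k + 2 .. 4 * int k + 3}" by (simp add: card_image inj_on_def)
  then have "even (card E)" by (simp add: even_nat_iff)
  then show ?thesis using gauss_lemma by simp
qed

lemma odd_power_add_1_not_dvd_by_7_mod_8:
  fixes p :: nat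
  assumes "prime p" "p mod 8 = 7" "odd n"
  shows "\<not> p dvd 2 ^ n + 1"
proof -
  have "p mod 4 = 3" using assms(2) by presburger
  then show ?thesis
    using not_dvd_odd_power_add_1_of_quadratic_residue[of p 2 n] Legendre_2_of_7_mod_8 assms by simp
qed

text \<open>Modulo \<open>q\<close> the number -1 is a square, so \<open>p ^ a = -1\<close> with
  \<open>a\<close> odd makes \<open>p\<close> a residue modulo \<open>q\<close>. Reciprocity makes
  \<open>q\<close> a residue modulo \<open>p\<close>, and the preceding obstruction applies.\<close>

lemma not_dvd_odd_power_add_1:
  fixes p q :: nat
  assumes "prime p" "p mod 4 = 3" "prime q" "q mod 4 = 1" "odd a" "q dvd p ^ a + 1" "odd n"
  shows "\<not> p dvd q ^ n + 1"
proof -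
  have "q > 2" using assms prime_ge_2_nat[OF assms(3)] by (cases "q = 2") auto
  have "p > 2" using assms prime_ge_2_nat[OF assms(1)] by (cases "p = 2") auto
  have "p \<noteq> q" using assms by auto
  define h where "h = (q - 1) div 2"
  have "even h" using assms(4) unfolding h_def by presburger
  have "Legendre (int p) (int q) = 1"
  proof -
    have "[int p ^ a = - 1] (mod int q)"
      using assms(6) unfolding cong_iff_dvd_diff
      by (metis diff_minus_eq_add int_dvd_int_iff of_nat_1 of_nat_add of_nat_power)
    then have "[(int p ^ a) ^ h = (- 1) ^ h] (mod int q)" by (rule cong_pow)
    then have 1: "[(int p ^ h) ^ a = 1] (mod int q)"
      using \<open>even h\<close> by (simp add: power_mult[symmetric] mult.commute)
    have "[Legendre (int p) (int q) = int p ^ h] (mod int q)"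
      using euler_criterion[OF assms(3) \<open>q > 2\<close>] by (simp add: h_def)
    then have "[Legendre (int p) (int q) ^ a = (int p ^ h) ^ a] (mod int q)" by (rule cong_pow)
    then have "[Legendre (int p) (int q) ^ a = 1] (mod int q)" using 1 cong_trans by blast
    moreover have "Legendre (int p) (int q) \<in> {1, -1, 0}" by (auto simp: Legendre_def)
    moreover have "\<not> int q dvd 2" "\<not> int q dvd 1" using \<open>q > 2\<close> by (auto dest: zdvd_imp_le)
    ultimately show ?thesis using \<open>odd a\<close> odd_pos[OF \<open>odd a\<close>] by (auto simp: cong_iff_dvd_diff zero_power)
  qed
  moreover have "Legendre (int p) (int q) * Legendre (int q) (int p) = 1"
    using Quadratic_Reciprocity[OF assms(1) \<open>p > 2\<close> assms(3) \<open>q > 2\<close> \<open>p \<noteq> q\<close>] \<open>even h\<close>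
    by (simp add: h_def)
  ultimately have "Legendre (int q) (int p) = 1" by simp
  then show ?thesis using not_dvd_odd_power_add_1_of_quadratic_residue assms by blast
qed

section \<open>The exponent pairs of an odd unitary super perfect number\<close>

text \<open>Weierstrass' inequality is applied only outside \<open>D\<close>. Elements of
  \<open>D\<close> outside \<open>S\<close> contribute factors at most 1, so \<open>D\<close> may
  list elements that are not known to occur.\<close>

lemma prod_one_minus_lower_bound:
  fixes w :: "'a \<Rightarrow> real"
  assumes "finite S" "finite D" "\<And>s. 0 \<le> w s \<and> w s \<le> 1"
  shows "(\<Prod>s\<in>D. 1 - w s) * (1 - (\<Sum>s\<in>S - D. w s)) \<le> (\<Prod>s\<in>S. 1 - w s)"
proof -
  have nonneg: "0 \<le> (\<Prod>s\<in>A. 1 - w s)" for A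
    using assms(3) by (intro prod_nonneg) auto
  have "(\<Prod>s\<in>D. 1 - w s) = (\<Prod>s\<in>D - S. 1 - w s) * (\<Prod>s\<in>S \<inter> D. 1 - w s)"
    using assms(2) by (metis Int_commute Diff_Int2 inf.cobounded1 Diff_Int_distrib prod.Int_Diff mult.commute)
  also have "\<dots> \<le> (\<Prod>s\<in>S \<inter> D. 1 - w s)"
    using assms(3) nonneg by (intro mult_left_le_one_le prod_le_1) auto
  finally have D: "(\<Prod>s\<in>D. 1 - w s) \<le> (\<Prod>s\<in>S \<inter> D. 1 - w s)" .
  have "(\<Prod>s\<in>D. 1 - w s) * (1 - (\<Sum>s\<in>S - D. w s)) \<le> (\<Prod>s\<in>D. 1 - w s) * (\<Prod>s\<in>S - D. 1 - w s)"
    using assms(3) nonneg by (intro mult_left_mono Weierstrass_prod_ineq) auto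
  also have "\<dots> \<le> (\<Prod>s\<in>S \<inter> D. 1 - w s) * (\<Prod>s\<in>S - D. 1 - w s)"
    using D nonneg by (intro mult_right_mono)
  also have "\<dots> = (\<Prod>s\<in>S. 1 - w s)"
    using prod.Int_Diff[OF assms(1)] by metis
  finally show ?thesis .
qed

lemma geometric_sum_le:
  fixes r :: real
  assumes "finite A" "0 \<le> r" "r < 1" "\<And>n. n \<in> A \<Longrightarrow> m \<le> n"
  shows "(\<Sum>n\<in>A. r ^ n) \<le> r ^ m / (1 - r)"
proof -
  have "summable (\<lambda>n. r ^ n)" using assms by (intro summable_geometric) auto
  have "(\<Sum>n\<in>A. r ^ n) = (\<Sum>n\<in>(\<lambda>n. n - m) ` A. r ^ (n + m))"
    using assms(4) by (subst sum.reindex) (auto intro!: inj_on_diff_nat)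
  also have "\<dots> = r ^ m * (\<Sum>n\<in>(\<lambda>n. n - m) ` A. r ^ n)"
    by (simp add: power_add sum_distrib_left mult.commute)
  also have "\<dots> \<le> r ^ m * (\<Sum>n. r ^ n)"
    using assms \<open>summable _\<close> by (intro mult_left_mono sum_le_suminf) auto
  finally show ?thesis using assms suminf_geometric[of r] by simp
qed

lemma power_mod_eq_1:
  fixes x m :: nat
  assumes "x mod m = 1"
  shows "x ^ k mod m = 1"
  using assms by (metis mod_mod_trivial power_mod power_one)

lemma prime_power_eq_prime:
  fixes p r :: nat
  assumes "p ^ k = r" "prime r"
  shows "p = r \<and> k = 1"
  using assms by (metis power_one_right prime_power_iff)

lemma power_4_mod_5: "(4::nat) ^ k mod 5 = 1 \<or> (4::nat) ^ k mod 5 = 4"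
proof (induction k)
  case (Suc k)
  then show ?case using mod_mult_right_eq[of "4::nat" "4 ^ k" 5] by auto
qed simp

text \<open>The powers of 4 form a subgroup of order four modulo 17, which also contains 81 = 13.
  These residues serve to exclude the prime 17 when \<open>q = 3\<close>.\<close>

lemma power_4_mod_17:
  "(4::nat) ^ k mod 17 = 1 \<or> (4::nat) ^ k mod 17 = 4 \<or> (4::nat) ^ k mod 17 = 13 \<or> (4::nat) ^ k mod 17 = 16"
proof (induction k)
  case (Suc k)
  then show ?case using mod_mult_right_eq[of "4::nat" "4 ^ k" 17] by auto
qed simp

lemma power_81_mod_17:
  "(81::nat) ^ k mod 17 = 1 \<or> (81::nat) ^ k mod 17 = 4 \<or> (81::nat) ^ k mod 17 = 13 \<or> (81::nat) ^ k mod 17 = 16"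
proof (induction k)
  case (Suc k)
  then show ?case using mod_mult_right_eq[of "81::nat" "81 ^ k" 17] by auto
qed simp

section \<open>Arithmetic constraints on the exponents of an odd solution\<close>

locale odd_usp =
  fixes N q e f :: nat and i j :: "nat \<Rightarrow> nat"
  assumes N_pos: "N > 0" and odd_N: "odd N" and prime_q: "prime q" and odd_q: "odd q" and f_pos: "f > 0"
    and twice_N: "2 * N = (2 ^ e + 1) * (q ^ f + 1)"
    and component: "p \<in> prime_factors N \<Longrightarrow> p ^ multiplicity p N + 1 = 2 ^ i p * q ^ j p"
    and sum_i: "(\<Sum>p\<in>prime_factors N. i p) = e" and sum_j: "(\<Sum>p\<in>prime_factors N. j p) = f"
begin

text \<open>A set suffices since a pair determines its prime (\<open>inj_exponents\<close>).\<close>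

definition exponent_pairs :: "(nat \<times> nat) set" where
  "exponent_pairs = (\<lambda>p. (i p, j p)) ` prime_factors N"

text \<open>At the pair of \<open>p\<close> this is the reciprocal of
  \<open>p ^ multiplicity p N + 1\<close>, so \<open>1 - weight s\<close> is the share of
  \<open>p\<close> in N / unitary_sigma N.\<close>

definition weight :: "nat \<times> nat \<Rightarrow> real" where
  "weight s = 1 / (2 ^ fst s * real q ^ snd s)"

lemma q_ge_3: "q \<ge> 3"
  using prime_ge_2_nat[OF prime_q] odd_q by (cases "q = 2") auto

lemma prime_factorD:
  assumes "p \<in> prime_factors N"
  shows "prime p" "odd p" "p \<ge> 3" "multiplicity p N > 0" "p dvd 2 ^ e + 1 \<or> p dvd q ^ f + 1"
proof -
  show "prime p" using assms by auto
  show "odd p" using assms odd_N by (auto simp: in_prime_factors_iff)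
  then show "p \<ge> 3" using prime_ge_2_nat[OF \<open>prime p\<close>] by (cases "p = 2") auto
  show "multiplicity p N > 0" using assms by (simp add: prime_factors_multiplicity)
  have "p dvd 2 * N" using assms by (simp add: in_prime_factors_iff)
  then show "p dvd 2 ^ e + 1 \<or> p dvd q ^ f + 1"
    unfolding twice_N using \<open>prime p\<close> prime_dvd_mult_iff by blast
qed

lemma e_pos: "e > 0"
proof (rule ccontr)
  assume "\<not> e > 0"
  then have "N = q ^ f + 1" using twice_N by simp
  then show False using odd_N odd_q by simp
qed

lemma q_power_mod_4: "q ^ f mod 4 = 1"
proof (rule ccontr)
  have "odd (q ^ f)" using odd_q by simp
  moreover assume "q ^ f mod 4 \<noteq> 1"
  ultimately have "4 dvd q ^ f + 1" by presburger
  then have "4 dvd 2 * N" unfolding twice_N by (rule dvd_mult)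
  then show False using odd_N by presburger
qed

text \<open>Odd squares are 1 modulo 4, so for odd \<open>f\<close> the power \<open>q ^ f\<close>
  has the residue of \<open>q\<close>.\<close>

lemma q_mod_4:
  assumes "odd f"
  shows "q mod 4 = 1"
proof -
  obtain k where k: "f = Suc (2 * k)" using assms by (metis oddE Suc_eq_plus1)
  have "q * q mod 4 = 1"
  proof -
    have "q mod 4 = 1 \<or> q mod 4 = 3" using odd_q by presburger
    then show ?thesis by (subst mod_mult_eq[symmetric]) auto
  qed
  then have "(q * q) ^ k mod 4 = 1" by (rule power_mod_eq_1)
  then have "q ^ f mod 4 = q mod 4"
    unfolding k by (metis power_Suc power_mult power2_eq_square mod_mult_right_eq mult.right_neutral)
  then show ?thesis using q_power_mod_4 by simp
qed

lemma i_pos: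
  assumes "p \<in> prime_factors N"
  shows "i p > 0"
proof (rule ccontr)
  assume "\<not> i p > 0"
  then have "p ^ multiplicity p N + 1 = q ^ j p" using component[OF assms] by simp
  moreover have "odd (p ^ multiplicity p N)" "odd (q ^ j p)" using prime_factorD(2)[OF assms] odd_q by simp_all
  ultimately show False by (metis odd_even_add odd_one)
qed

lemma residue_mod_4:
  assumes "p \<in> prime_factors N" "i p \<ge> 2"
  shows "p mod 4 = 3" "odd (multiplicity p N)"
proof -
  let ?a = "multiplicity p N"
  have "2 ^ 2 dvd 2 ^ i p * q ^ j p" using assms(2) by (intro dvd_mult2 le_imp_power_dvd)
  then have "4 dvd p ^ ?a + 1" using component[OF assms(1)] by simp
  then have m: "p ^ ?a mod 4 = 3" by presburger
  have "p mod 4 = 1 \<or> p mod 4 = 3" using prime_factorD(2)[OF assms(1)] by presburger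
  moreover have "p mod 4 \<noteq> 1"
  proof
    assume "p mod 4 = 1"
    then have "p ^ ?a mod 4 = 1" by (rule power_mod_eq_1)
    then show False using m by simp
  qed
  ultimately show p: "p mod 4 = 3" by blast
  show "odd ?a"
  proof
    assume "even ?a"
    then obtain k where "?a = 2 * k" by blast
    moreover have "p ^ 2 mod 4 = 1"
      unfolding power2_eq_square using p by (subst mod_mult_eq[symmetric]) simp
    ultimately have "p ^ ?a mod 4 = 1" by (metis power_mult power_mod_eq_1)
    then show False using m by simp
  qed
qed

lemma residue_mod_8:
  assumes "p \<in> prime_factors N" "i p \<ge> 3"
  shows "p mod 8 = 7"
proof -
  obtain k where k: "multiplicity p N = Suc (2 * k)"
    using residue_mod_4(2) assms by (metis oddE Suc_eq_plus1 le_trans numeral_2_eq_2 numeral_3_eq_3 le_SucI order_refl)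
  have "2 ^ 3 dvd 2 ^ i p * q ^ j p" using assms(2) by (intro dvd_mult2 le_imp_power_dvd)
  then have "8 dvd p ^ multiplicity p N + 1" using component[OF assms(1)] by simp
  then have m: "p ^ multiplicity p N mod 8 = 7" by presburger
  have "p ^ 2 mod 8 = 1"
    using square_mod_8_eq_1_iff[of p] prime_factorD(2)[OF assms(1)] by (simp add: cong_def)
  then have "(p ^ 2) ^ k mod 8 = 1" by (rule power_mod_eq_1)
  then have "p ^ multiplicity p N mod 8 = p mod 8"
    unfolding k by (metis power_Suc power_mult mod_mult_right_eq mult.right_neutral)
  then show ?thesis using m by simp
qed

text \<open>If \<open>i p\<close> is at least 2, then \<open>p\<close> is 3 modulo 4 and cannot
  divide \<open>q ^ f + 1\<close>: for even \<open>f\<close> because -1 is a non-residue, for odd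
  \<open>f\<close> by reciprocity, as \<open>q\<close> divides the component plus 1. So
  \<open>p\<close> divides \<open>2 ^ e + 1\<close>, which makes \<open>e\<close> odd;
  \<open>i p\<close> at least 3 would make \<open>p\<close> 7 modulo 8, where 2 is a
  residue.\<close>

lemma exponent_of_two_cases:
  assumes p: "p \<in> prime_factors N" and "even f \<or> j p > 0"
  shows "i p = 1 \<or> (i p = 2 \<and> odd e)"
proof (cases "i p = 1")
  case False
  then have i2: "i p \<ge> 2" using i_pos[OF p] by simp
  note p3 = residue_mod_4(1)[OF p i2]
  have "\<not> p dvd q ^ f + 1"
  proof (cases "even f")
    case True
    then show ?thesis using not_dvd_even_power_add_1 prime_factorD(1)[OF p] p3 by blast
  next
    case False
    then have "q dvd 2 ^ i p * q ^ j p" using assms(2) by (simp add: dvd_power)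
    then show ?thesis
      using not_dvd_odd_power_add_1[OF prime_factorD(1)[OF p] p3 prime_q q_mod_4[OF False] residue_mod_4(2)[OF p i2] _ False]
        component[OF p] by simp
  qed
  then have dvd: "p dvd 2 ^ e + 1" using prime_factorD(5)[OF p] by blast
  then have "odd e" using not_dvd_even_power_add_1 prime_factorD(1)[OF p] p3 by blast
  moreover have "\<not> i p \<ge> 3"
    using residue_mod_8[OF p] odd_power_add_1_not_dvd_by_7_mod_8 prime_factorD(1)[OF p] \<open>odd e\<close> dvd by blast
  ultimately show ?thesis using i2 by simp
qed simp

text \<open>The pair \<open>(1, 0)\<close> would give the prime power 1 and \<open>(4, 0)\<close> the prime power 15.\<close>

lemma mersenne_exponent:
  assumes p: "p \<in> prime_factors N" and "j p = 0"
  shows "i p \<ge> 2" "i p \<noteq> 4"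
proof -
  have c: "p ^ multiplicity p N + 1 = 2 ^ i p" using component[OF p] assms(2) by simp
  have "p ^ multiplicity p N \<ge> p" using prime_factorD[OF p] by (intro self_le_power) auto
  then have "2 ^ i p \<ge> (4::nat)" using prime_factorD(3)[OF p] c by simp
  then show "i p \<ge> 2" using power_increasing[of "i p" 1 "2::nat"] by (cases "i p \<ge> 2") auto
  show "i p \<noteq> 4"
  proof
    assume "i p = 4"
    then have "p ^ multiplicity p N = 15" using c by simp
    then have "3 dvd p ^ multiplicity p N" "5 dvd p ^ multiplicity p N" by simp_all
    then have "3 dvd p" "5 dvd p" by (auto dest!: prime_dvd_power_nat[rotated])
    then show False using prime_factorD(1)[OF p] primes_dvd_imp_eq[of 3 p] primes_dvd_imp_eq[of 5 p] by simp
  qed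
qed

lemma inj_exponents: "inj_on (\<lambda>p. (i p, j p)) (prime_factors N)"
proof (rule inj_onI)
  fix p p' assume p: "p \<in> prime_factors N" "p' \<in> prime_factors N" and "(i p, j p) = (i p', j p')"
  then have "p ^ multiplicity p N = p' ^ multiplicity p' N"
    using component[OF p(1)] component[OF p(2)] by simp
  then have "p dvd p' ^ multiplicity p' N" using prime_factorD(4)[OF p(1)] by (metis dvd_power)
  then show "p = p'" using p prime_factorD(1) by (meson prime_dvd_power_nat primes_dvd_imp_eq)
qed

lemma finite_pairs: "finite exponent_pairs"
  by (simp add: exponent_pairs_def)

lemma pair_imp_prime:
  assumes "(a, b) \<in> exponent_pairs" "2 ^ a * q ^ b = r + 1" "prime r"
  shows "r \<in> prime_factors N" "multiplicity r N = 1" "i r = a" "j r = b"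
proof -
  obtain p where p: "p \<in> prime_factors N" "i p = a" "j p = b"
    using assms(1) by (auto simp: exponent_pairs_def)
  then have "p ^ multiplicity p N = r" using component[OF p(1)] assms(2) by simp
  then have "p = r \<and> multiplicity p N = 1" using assms(3) by (rule prime_power_eq_prime)
  then show "r \<in> prime_factors N" "multiplicity r N = 1" "i r = a" "j r = b" using p by auto
qed

lemma i_add_le_e:
  assumes "p \<in> prime_factors N" "p' \<in> prime_factors N" "p \<noteq> p'"
  shows "i p + i p' \<le> e"
proof -
  have "(\<Sum>p\<in>{p, p'}. i p) \<le> (\<Sum>p\<in>prime_factors N. i p)"
    using assms by (intro sum_mono2) auto
  then show ?thesis using assms(3) sum_i by simp
qed

lemma j_le_f: "p \<in> prime_factors N \<Longrightarrow> j p \<le> f"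
  using sum_j member_le_sum[of p "prime_factors N" j] by simp

lemma single_prime_factor:
  assumes "prime_factors N = {p}"
  shows "N = 9"
proof -
  let ?x = "2 ^ e :: nat" and ?y = "q ^ f"
  have "N = p ^ multiplicity p N" using prime_factorization_nat[OF N_pos] assms by simp
  then have "N + 1 = ?x * ?y" using component[of p] sum_i sum_j assms by simp
  \<comment> \<open>Equivalently (2^e - 1)(q^f - 1) = 4. The shifted variables \<open>x\<close>,
    \<open>y\<close> below avoid natural subtraction; parity leaves 2^e = 2 and q^f = 5.\<close>
  then have "?x * ?y = ?x + ?y + 3" using twice_N by (simp add: algebra_simps)
  moreover have "?x \<ge> 2 ^ 1" using e_pos by (intro power_increasing) auto
  then obtain x where x: "?x = Suc (Suc x)"
    by (metis Suc_le_D Suc_le_mono numeral_2_eq_2 power_one_right)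
  moreover have "?y \<ge> q" using f_pos q_ge_3 by (intro self_le_power) auto
  then have "?y \<ge> Suc (Suc 0)" using q_ge_3 by linarith
  then obtain y where y: "?y = Suc (Suc y)" by (metis Suc_le_D Suc_le_mono)
  ultimately have eq: "(x + 1) * (y + 1) = 4" by (simp add: algebra_simps)
  have "even x" using x e_pos by (metis even_Suc even_power even_numeral)
  have "x + 1 dvd 4" using eq by (metis dvd_triv_left)
  then have "x + 1 \<le> 4" by (rule dvd_imp_le) simp
  then have "x = 0 \<or> x = 2" using \<open>even x\<close> by presburger
  then have "x = 0" "y = 3" using eq by auto
  then show ?thesis using twice_N x y by simp
qed

lemma another_prime_factor:
  assumes "N \<noteq> 9" "p \<in> prime_factors N"
  obtains p' where "p' \<in> prime_factors N" "p' \<noteq> p"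
  using single_prime_factor assms by blast

section \<open>The weight identity and the inequality derived from it\<close>

lemma weight_eq: "weight (a, b) = 1 / (2 ^ a * real q ^ b)"
  by (simp add: weight_def)

lemma weight_bounds: "0 \<le> weight s \<and> weight s \<le> 1"
proof -
  have "(1::real) * 1 \<le> 2 ^ fst s * real q ^ snd s"
    using q_ge_3 by (intro mult_mono one_le_power) auto
  then show ?thesis by (simp add: weight_def)
qed

text \<open>Both sides equal 2N / (2^e q^f): the left through the components of \<open>N\<close>,
  the right through \<open>twice_N\<close>.\<close>

lemma prod_weight: "2 * (\<Prod>s\<in>exponent_pairs. 1 - weight s) = (1 + 1 / 2 ^ e) * (1 + 1 / real q ^ f)"
proof -
  have "(\<Prod>s\<in>exponent_pairs. 1 - weight s) = (\<Prod>p\<in>prime_factors N. 1 - weight (i p, j p))"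
    unfolding exponent_pairs_def by (simp add: prod.reindex[OF inj_exponents])
  also have "\<dots> = (\<Prod>p\<in>prime_factors N. real (p ^ multiplicity p N) / (2 ^ i p * real q ^ j p))"
  proof (rule prod.cong)
    fix p assume "p \<in> prime_factors N"
    then have "real (p ^ multiplicity p N) + 1 = 2 ^ i p * real q ^ j p"
      using component[of p] by (metis of_nat_1 of_nat_add of_nat_mult of_nat_numeral of_nat_power)
    then have "real (p ^ multiplicity p N) = 2 ^ i p * real q ^ j p - 1" by simp
    then show "1 - weight (i p, j p) = real (p ^ multiplicity p N) / (2 ^ i p * real q ^ j p)"
      using q_ge_3 by (simp add: weight_eq diff_divide_distrib)
  qed simp
  also have "\<dots> = real N / (2 ^ e * real q ^ f)"
    unfolding prod_dividef prod.distrib power_sum[symmetric] sum_i sum_j of_nat_prod[symmetric]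
    using prime_factorization_nat[OF N_pos] by simp
  finally have *: "(\<Prod>s\<in>exponent_pairs. 1 - weight s) = real N / (2 ^ e * real q ^ f)" .
  have "2 * real N = (2 ^ e + 1) * (real q ^ f + 1)"
    using arg_cong[OF twice_N, of real] by (simp only: of_nat_mult of_nat_add of_nat_power of_nat_numeral of_nat_1)
  then show ?thesis unfolding * using q_ge_3 by (simp add: field_simps)
qed

lemma column_sum_le:
  "(\<Sum>s\<in>{s\<in>exponent_pairs. fst s = a \<and> m \<le> snd s}. weight s) \<le> 1 / (2 ^ a * real q ^ m) * (q / (real q - 1))"
proof -
  let ?A = "{s\<in>exponent_pairs. fst s = a \<and> m \<le> snd s}"
  have "inj_on snd ?A" by (auto simp: inj_on_def)
  then have "(\<Sum>b\<in>snd ` ?A. (1 / real q) ^ b) = (\<Sum>s\<in>?A. (1 / real q) ^ snd s)"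
    by (simp add: sum.reindex)
  moreover have "(\<Sum>b\<in>snd ` ?A. (1 / real q) ^ b) \<le> (1 / real q) ^ m / (1 - 1 / real q)"
    using finite_pairs q_ge_3 by (intro geometric_sum_le) auto
  moreover have "(\<Sum>s\<in>?A. weight s) = 1 / 2 ^ a * (\<Sum>s\<in>?A. (1 / real q) ^ snd s)"
    unfolding sum_distrib_left by (intro sum.cong) (auto simp: weight_def power_one_over)
  ultimately have "(\<Sum>s\<in>?A. weight s) \<le> 1 / 2 ^ a * ((1 / real q) ^ m / (1 - 1 / real q))"
    by (simp only: mult_left_mono zero_le_divide_1_iff zero_le_power zero_le_numeral)
  also have "\<dots> = 1 / (2 ^ a * real q ^ m) * (q / (real q - 1))"
    using q_ge_3 by (simp add: field_simps)
  finally show ?thesis .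
qed

lemma mersenne_sum_le:
  "(\<Sum>s\<in>{s\<in>exponent_pairs. snd s = 0 \<and> m \<le> fst s}. weight s) \<le> 2 / 2 ^ m"
proof -
  let ?A = "{s\<in>exponent_pairs. snd s = 0 \<and> m \<le> fst s}"
  have "inj_on fst ?A" by (auto simp: inj_on_def)
  then have "(\<Sum>b\<in>fst ` ?A. (1 / 2 :: real) ^ b) = (\<Sum>s\<in>?A. (1 / 2) ^ fst s)"
    by (simp add: sum.reindex)
  moreover have "(\<Sum>b\<in>fst ` ?A. (1 / 2 :: real) ^ b) \<le> (1 / 2) ^ m / (1 - 1 / 2)"
    using finite_pairs by (intro geometric_sum_le) auto
  moreover have "(\<Sum>s\<in>?A. weight s) = (\<Sum>s\<in>?A. (1 / 2) ^ fst s)"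
    by (intro sum.cong) (auto simp: weight_def power_one_over)
  ultimately show ?thesis by (simp add: power_one_over)
qed

text \<open>
  The pairs outside \<open>D\<close> lie on three rays, over which the weights form geometric series.
  A ray that is not needed is made harmless by starting it at 20.
\<close>

lemma weight_inequality:
  assumes "finite D" "e0 \<le> e" "y \<le> q ^ f" "y > 0"
    and rays: "\<And>a b. (a, b) \<in> exponent_pairs \<Longrightarrow> (a, b) \<notin> D \<Longrightarrow>
      (a = 1 \<and> m1 \<le> b) \<or> (a = 2 \<and> m2 \<le> b) \<or> (b = 0 \<and> m0 \<le> a)"
  shows "2 * (\<Prod>s\<in>D. 1 - weight s) *
      (1 - (1 / (2 * real q ^ m1) + 1 / (4 * real q ^ m2)) * (q / (real q - 1)) - 2 / 2 ^ m0)
    \<le> (1 + 1 / 2 ^ e0) * (1 + 1 / real y)"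
proof -
  let ?R1 = "{s\<in>exponent_pairs. fst s = 1 \<and> m1 \<le> snd s}"
  let ?R2 = "{s\<in>exponent_pairs. fst s = 2 \<and> m2 \<le> snd s}"
  let ?R0 = "{s\<in>exponent_pairs. snd s = 0 \<and> m0 \<le> fst s}"
  \<comment> \<open>The rays may overlap, so subadditivity is used in place of a disjoint
    sum.\<close>
  have union: "sum weight (A \<union> B) \<le> sum weight A + sum weight B" if "finite A" "finite B" for A B
    using that weight_bounds by (simp add: sum_Un sum_nonneg)
  have "sum weight (exponent_pairs - D) \<le> sum weight (?R1 \<union> ?R2 \<union> ?R0)"
    using rays finite_pairs weight_bounds by (intro sum_mono2) (auto, force+)
  also have "\<dots> \<le> sum weight ?R1 + sum weight ?R2 + sum weight ?R0"
    using union[of "?R1 \<union> ?R2" ?R0] union[of ?R1 ?R2] finite_pairs by fastforce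
  finally have sum: "sum weight (exponent_pairs - D)
      \<le> (1 / (2 * real q ^ m1) + 1 / (4 * real q ^ m2)) * (q / (real q - 1)) + 2 / 2 ^ m0"
    using column_sum_le[of 1 m1] column_sum_le[of 2 m2] mersenne_sum_le[of m0]
    unfolding distrib_right by simp
  have "2 * (\<Prod>s\<in>D. 1 - weight s) *
      (1 - (1 / (2 * real q ^ m1) + 1 / (4 * real q ^ m2)) * (q / (real q - 1)) - 2 / 2 ^ m0)
    \<le> 2 * (\<Prod>s\<in>D. 1 - weight s) * (1 - sum weight (exponent_pairs - D))"
    using sum weight_bounds by (intro mult_left_mono mult_nonneg_nonneg prod_nonneg) auto
  also have "\<dots> \<le> 2 * (\<Prod>s\<in>exponent_pairs. 1 - weight s)"
    using prod_one_minus_lower_bound[OF finite_pairs assms(1) weight_bounds] by simp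
  also have "\<dots> = (1 + 1 / 2 ^ e) * (1 + 1 / real q ^ f)" by (rule prod_weight)
  also have "\<dots> \<le> (1 + 1 / 2 ^ e0) * (1 + 1 / real y)"
  proof -
    have "(2::real) ^ e0 \<le> 2 ^ e" using assms(2) by (rule power_increasing) simp
    moreover have "real y \<le> real q ^ f" using assms(3) by (metis of_nat_le_iff of_nat_power)
    ultimately show ?thesis using \<open>y > 0\<close> q_ge_3
      by (intro mult_mono add_left_mono divide_left_mono) auto
  qed
  finally show ?thesis .
qed

section \<open>Elimination of the exponent pairs\<close>

text \<open>With both columns starting at 1 their total is at most 3/(4(q - 1)), which decreases in
  \<open>q\<close>. It is applied to sets \<open>D\<close> of pairs with second entry 0, whose
  weights are free of \<open>q\<close>.\<close>

lemma weight_inequality_first_column: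
  assumes "finite D" "e0 \<le> e" "y \<le> q ^ f" "y > 0" "q0 \<le> q" "q0 > 1"
    and rays: "\<And>a b. (a, b) \<in> exponent_pairs \<Longrightarrow> (a, b) \<notin> D \<Longrightarrow>
      (a = 1 \<and> 1 \<le> b) \<or> (a = 2 \<and> 1 \<le> b) \<or> (b = 0 \<and> m0 \<le> a)"
  shows "2 * (\<Prod>s\<in>D. 1 - weight s) * (1 - 3 / (4 * (real q0 - 1)) - 2 / 2 ^ m0)
    \<le> (1 + 1 / 2 ^ e0) * (1 + 1 / real y)"
proof -
  have "(1 / (2 * real q ^ 1) + 1 / (4 * real q ^ 1)) * (q / (real q - 1)) = 3 / (4 * (real q - 1))"
    using q_ge_3 by (simp add: field_simps)
  also have "\<dots> \<le> 3 / (4 * (real q0 - 1))"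
    using assms(5,6) by (intro divide_left_mono) auto
  finally have "2 * (\<Prod>s\<in>D. 1 - weight s) * (1 - 3 / (4 * (real q0 - 1)) - 2 / 2 ^ m0)
    \<le> 2 * (\<Prod>s\<in>D. 1 - weight s) *
      (1 - (1 / (2 * real q ^ 1) + 1 / (4 * real q ^ 1)) * (q / (real q - 1)) - 2 / 2 ^ m0)"
    using weight_bounds by (intro mult_left_mono mult_nonneg_nonneg prod_nonneg) auto
  also have "\<dots> \<le> (1 + 1 / 2 ^ e0) * (1 + 1 / real y)"
    using assms by (intro weight_inequality) auto
  finally show ?thesis .
qed

lemma exponent_pair_cases:
  assumes "(a, b) \<in> exponent_pairs"
  shows "(a = 1 \<and> 1 \<le> b) \<or> (a = 2 \<and> 1 \<le> b \<and> odd e) \<or> (b = 0 \<and> (a = 2 \<or> a = 3 \<or> a \<ge> 5))"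
proof -
  obtain p where p: "p \<in> prime_factors N" "i p = a" "j p = b"
    using assms by (auto simp: exponent_pairs_def)
  show ?thesis
  proof (cases "b = 0")
    case True
    then have "a \<ge> 2 \<and> a \<noteq> 4" using mersenne_exponent[OF p(1)] p by simp
    then show ?thesis using True by linarith
  next
    case False
    then show ?thesis using exponent_of_two_cases[OF p(1)] p by auto
  qed
qed

lemma exponent_pair_cases_even:
  assumes "(a, b) \<in> exponent_pairs" "even f"
  shows "(a = 1 \<and> 1 \<le> b) \<or> (a = 2 \<and> odd e)"
  using assms exponent_of_two_cases mersenne_exponent(1)
  by (fastforce simp: exponent_pairs_def)

lemma exponent_pair_add_le_e:
  assumes "(a, b) \<in> exponent_pairs" "(a', b') \<in> exponent_pairs" "(a, b) \<noteq> (a', b')"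
  shows "a + a' \<le> e"
  using assms i_add_le_e by (fastforce simp: exponent_pairs_def)

text \<open>Apart from \<open>N = 9\<close> there is a second prime factor, which takes at least 1
  from the sum \<open>e\<close>.\<close>

lemma exponent_pair_less_e:
  assumes "N \<noteq> 9" "(a, b) \<in> exponent_pairs"
  shows "a < e"
proof -
  obtain p where p: "p \<in> prime_factors N" "i p = a" "j p = b"
    using assms(2) by (auto simp: exponent_pairs_def)
  obtain p' where p': "p' \<in> prime_factors N" "p' \<noteq> p" using another_prime_factor assms(1) p by blast
  show ?thesis using i_add_le_e[OF p(1) p'(1)] p' i_pos[OF p'(1)] p by simp
qed

lemma e_ge_2:
  assumes "N \<noteq> 9"
  shows "e \<ge> 2"
proof -
  have "sum i (prime_factors N) \<noteq> 0" using sum_i e_pos by simp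
  then obtain p where "p \<in> prime_factors N" by (metis sum.neutral)
  then have "(i p, j p) \<in> exponent_pairs" "i p > 0" using i_pos by (auto simp: exponent_pairs_def)
  then show ?thesis using exponent_pair_less_e[OF assms, of "i p"] by fastforce
qed

lemma q_power_mono: "q0 \<le> q \<Longrightarrow> k \<le> f \<Longrightarrow> q0 ^ k \<le> q ^ f"
  using q_ge_3 by (meson power_increasing power_mono le_trans le_numeral_extra(4) one_le_numeral zero_le)

lemma no_solution_even_f:
  assumes "N \<noteq> 9" "even f" "q \<ge> 5"
  shows False
proof -
  have "f \<ge> 2" using assms(2) f_pos by presburger
  then have y: "25 \<le> q ^ f" using q_power_mono[of 5 2] assms(3) by simp
  show False
  proof (cases "(2, 0) \<in> exponent_pairs")
    case True
    then have "3 \<le> e" using exponent_pair_less_e assms(1) by fastforce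
    \<comment> \<open>About 1.219 on the left against 1.17 on the right; without the pair (2, 0) it
      is about 1.625 against 1.3.\<close>
    then have "2 * (\<Prod>s\<in>{(2, 0)}. 1 - weight s) * (1 - 3 / (4 * (real 5 - 1)) - 2 / 2 ^ 20)
      \<le> (1 + 1 / 2 ^ 3) * (1 + 1 / real 25)"
    proof (intro weight_inequality_first_column)
      fix a b assume ab: "(a, b) \<in> exponent_pairs" "(a, b) \<notin> {(2, 0)}"
      then show "a = 1 \<and> 1 \<le> b \<or> a = 2 \<and> 1 \<le> b \<or> b = 0 \<and> 20 \<le> a"
        using exponent_pair_cases_even[OF ab(1) assms(2)] by auto
    qed (use y assms(3) \<open>3 \<le> e\<close> in auto)
    then show False by (simp add: weight_eq)
  next
    case False
    have "2 * (\<Prod>s\<in>{}. 1 - weight s) * (1 - 3 / (4 * (real 5 - 1)) - 2 / 2 ^ 20)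
      \<le> (1 + 1 / 2 ^ 2) * (1 + 1 / real 25)"
    proof (intro weight_inequality_first_column)
      fix a b assume ab: "(a, b) \<in> exponent_pairs"
      then show "a = 1 \<and> 1 \<le> b \<or> a = 2 \<and> 1 \<le> b \<or> b = 0 \<and> 20 \<le> a"
        using exponent_pair_cases_even[OF ab assms(2)] False by (cases "b = 0") auto
    qed (use y assms(3) e_ge_2[OF assms(1)] in auto)
    then show False by simp
  qed
qed

lemma no_solution_odd_f_large_q:
  assumes "N \<noteq> 9" "q \<ge> 13"
  shows False
proof -
  have y: "13 \<le> q ^ f" using q_power_mono[of 13 1] assms(2) f_pos by simp
  consider (both) "(2, 0) \<in> exponent_pairs" "(3, 0) \<in> exponent_pairs"
    | (three) "(2, 0) \<in> exponent_pairs" "(3, 0) \<notin> exponent_pairs"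
    | (none) "(2, 0) \<notin> exponent_pairs" by blast
  then show False
  proof cases
    case both
    then have "5 \<le> e" using exponent_pair_add_le_e by fastforce
    \<comment> \<open>The Mersenne ray starts at 5 because the exponent 4 is excluded. About 1.148
      against 1.111.\<close>
    then have "2 * (\<Prod>s\<in>{(2, 0), (3, 0)}. 1 - weight s) * (1 - 3 / (4 * (real 13 - 1)) - 2 / 2 ^ 5)
      \<le> (1 + 1 / 2 ^ 5) * (1 + 1 / real 13)"
    proof (intro weight_inequality_first_column)
      fix a b assume "(a, b) \<in> exponent_pairs" "(a, b) \<notin> {(2, 0), (3, 0)}"
      then show "a = 1 \<and> 1 \<le> b \<or> a = 2 \<and> 1 \<le> b \<or> b = 0 \<and> 5 \<le> a"
        using exponent_pair_cases[of a b] by auto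
    qed (use y assms(2) \<open>5 \<le> e\<close> in auto)
    then show False by (simp add: weight_eq)
  next
    case three
    then have "3 \<le> e" using exponent_pair_less_e assms(1) by fastforce
    then have "2 * (\<Prod>s\<in>{(2, 0)}. 1 - weight s) * (1 - 3 / (4 * (real 13 - 1)) - 2 / 2 ^ 5)
      \<le> (1 + 1 / 2 ^ 3) * (1 + 1 / real 13)"
    proof (intro weight_inequality_first_column)
      fix a b assume "(a, b) \<in> exponent_pairs" "(a, b) \<notin> {(2, 0)}"
      then show "a = 1 \<and> 1 \<le> b \<or> a = 2 \<and> 1 \<le> b \<or> b = 0 \<and> 5 \<le> a"
        using exponent_pair_cases[of a b] three(2) by auto
    qed (use y assms(2) \<open>3 \<le> e\<close> in auto)
    then show False by (simp add: weight_eq)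
  next
    case none
    \<comment> \<open>The pair (3, 0) is listed without being known to occur, so that the ray can
      start at 5.\<close>
    have "2 * (\<Prod>s\<in>{(3, 0)}. 1 - weight s) * (1 - 3 / (4 * (real 13 - 1)) - 2 / 2 ^ 5)
      \<le> (1 + 1 / 2 ^ 2) * (1 + 1 / real 13)"
    proof (intro weight_inequality_first_column)
      fix a b assume "(a, b) \<in> exponent_pairs" "(a, b) \<notin> {(3, 0)}"
      then show "a = 1 \<and> 1 \<le> b \<or> a = 2 \<and> 1 \<le> b \<or> b = 0 \<and> 5 \<le> a"
        using exponent_pair_cases[of a b] none by auto
    qed (use y assms e_ge_2 in auto)
    then show False by (simp add: weight_eq)
  qed
qed

lemma prime_dvd_N_iff:
  assumes "prime r" "odd r"
  shows "r dvd N \<longleftrightarrow> r dvd 2 ^ e + 1 \<or> r dvd q ^ f + 1"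
proof -
  have "r dvd N \<longleftrightarrow> r dvd 2 * N"
    using prime_dvd_multD[OF assms(1)] primes_dvd_imp_eq[OF assms(1) two_is_prime_nat] assms(2) by auto
  then show ?thesis unfolding twice_N using prime_dvd_mult_iff assms(1) by blast
qed

text \<open>When 3 divides \<open>N\<close> the first-column bound is too weak, so \<open>e\<close>
  and \<open>f\<close> are first pushed up to 4 and 3.\<close>

lemma no_solution_odd_f_q5:
  assumes "N \<noteq> 9" "odd f" "q = 5"
  shows False
proof -
  \<comment> \<open>A component of 5 would have \<open>j 5 = 0\<close>, hence \<open>i 5\<close> at
    least 2, which requires the prime to be 3 modulo 4. The exponent 2 is then excluded for
    \<open>e\<close>, as \<open>2 ^ 2 + 1 = 5\<close>.\<close>
  have "5 \<notin> prime_factors N"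
  proof
    assume p: "5 \<in> prime_factors N"
    then have "5 dvd (5::nat) ^ multiplicity 5 N" using prime_factorD(4)[OF p] by (metis dvd_power)
    then have "\<not> 5 dvd 2 ^ i 5 * q ^ j 5" unfolding component[OF p, symmetric] by presburger
    then have "j 5 = 0" using assms(3) by (cases "j 5") auto
    moreover have "\<not> i 5 \<ge> 2" using residue_mod_4(1)[OF p] by auto
    ultimately show False using mersenne_exponent(1)[OF p] by simp
  qed
  then have "e \<noteq> 2" using twice_N N_pos prime_dvd_N_iff[of 5] by (auto simp: in_prime_factors_iff)
  then have e3: "3 \<le> e" using e_ge_2[OF assms(1)] by simp
  have y: "5 \<le> q ^ f" using q_power_mono[of 5 1] assms(3) f_pos by simp
  show False
  proof (cases "(2, 0) \<in> exponent_pairs")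
    case True
    note three = pair_imp_prime[OF True, of 3, simplified]
    \<comment> \<open>For odd \<open>e\<close> both factors of \<open>2 * N\<close> would be
      divisible by 3, but the pair (2, 0) means that 3 divides \<open>N\<close> exactly
      once.\<close>
    have "even e"
    proof (rule ccontr)
      assume "odd e"
      have "[2 ^ e = (- 1) ^ e] (mod (3::int))" by (intro cong_pow) (simp add: cong_def)
      then have "(3::int) dvd 2 ^ e + 1" using \<open>odd e\<close> by (simp add: cong_iff_dvd_diff)
      moreover have "[5 ^ f = (- 1) ^ f] (mod (3::int))" by (intro cong_pow) (simp add: cong_def)
      then have "(3::int) dvd 5 ^ f + 1" using \<open>odd f\<close> by (simp add: cong_iff_dvd_diff)
      ultimately have "(3::int) * 3 dvd (2 ^ e + 1) * (5 ^ f + 1)" by (rule mult_dvd_mono)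
      also have "\<dots> = int (2 * N)"
        by (simp only: twice_N assms(3) of_nat_mult of_nat_add of_nat_power of_nat_numeral of_nat_1)
      finally have "9 dvd N" by presburger
      then have "3 ^ 2 dvd N" by simp
      then have "2 \<le> multiplicity 3 N" using N_pos by (intro multiplicity_geI) auto
      then show False using three by simp
    qed
    then have "4 \<le> e" using e3 by presburger
    \<comment> \<open>This pair belongs to the prime power \<open>9 = 2 * 5 - 1\<close>.\<close>
    have not_9: "(1, 1) \<notin> exponent_pairs"
    proof
      assume "(1, 1) \<in> exponent_pairs"
      then obtain p where p: "p \<in> prime_factors N" "i p = 1" "j p = 1" by (auto simp: exponent_pairs_def)
      then have "p ^ multiplicity p N = 3 ^ 2" using component[OF p(1)] assms(3) by simp
      then have "p dvd 3 ^ 2" using prime_factorD(4)[OF p(1)] by (metis dvd_power)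
      then have "p dvd 3" using prime_dvd_power_nat prime_factorD(1)[OF p(1)] by blast
      then have "p = 3" using primes_dvd_imp_eq[of p 3] prime_factorD(1)[OF p(1)] by simp
      then show False using three p by simp
    qed
    \<comment> \<open>For \<open>f = 1\<close> some pair has second entry 1, and even
      \<open>e\<close> forces its first entry to be 1.\<close>
    have "f \<noteq> 1"
    proof
      assume "f = 1"
      then have "sum j (prime_factors N) \<noteq> 0" using sum_j by simp
      then obtain p where p: "p \<in> prime_factors N" "j p \<noteq> 0" by (metis sum.neutral)
      then have "j p = 1" using j_le_f[OF p(1)] \<open>f = 1\<close> by simp
      moreover have "i p = 1" using exponent_of_two_cases[OF p(1)] p(2) \<open>even e\<close> by auto
      ultimately show False using p(1) not_9 by (force simp: exponent_pairs_def)
    qed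
    then have "3 \<le> f" using assms(2) f_pos by presburger
    then have "125 \<le> q ^ f" using q_power_mono[of 5 3] assms(3) by simp
    \<comment> \<open>About 1.116 against 1.071.\<close>
    have "2 * (\<Prod>s\<in>{(2, 0), (3, 0)}. 1 - weight s) *
        (1 - (1 / (2 * real q ^ 2) + 1 / (4 * real q ^ 1)) * (q / (real q - 1)) - 2 / 2 ^ 5)
      \<le> (1 + 1 / 2 ^ 4) * (1 + 1 / real 125)"
    proof (intro weight_inequality)
      fix a b assume ab: "(a, b) \<in> exponent_pairs" "(a, b) \<notin> {(2, 0), (3, 0)}"
      then show "a = 1 \<and> 2 \<le> b \<or> a = 2 \<and> 1 \<le> b \<or> b = 0 \<and> 5 \<le> a"
        using exponent_pair_cases[OF ab(1)] not_9 by (cases "b = 1") auto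
    qed (use \<open>125 \<le> q ^ f\<close> \<open>4 \<le> e\<close> in auto)
    then show False by (simp add: assms(3) weight_eq[unfolded assms(3)])
  next
    case no3: False
    show False
    proof (cases "(3, 0) \<in> exponent_pairs")
      case True
      then have "4 \<le> e" using exponent_pair_less_e assms(1) by fastforce
      then have "2 * (\<Prod>s\<in>{(3, 0)}. 1 - weight s) * (1 - 3 / (4 * (real 5 - 1)) - 2 / 2 ^ 5)
        \<le> (1 + 1 / 2 ^ 4) * (1 + 1 / real 5)"
      proof (intro weight_inequality_first_column)
        fix a b assume "(a, b) \<in> exponent_pairs" "(a, b) \<notin> {(3, 0)}"
        then show "a = 1 \<and> 1 \<le> b \<or> a = 2 \<and> 1 \<le> b \<or> b = 0 \<and> 5 \<le> a"
          using exponent_pair_cases[of a b] no3 by auto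
      qed (use y assms(3) \<open>4 \<le> e\<close> in auto)
      then show False by (simp add: weight_eq)
    next
      case False
      then have "2 * (\<Prod>s\<in>{}. 1 - weight s) * (1 - 3 / (4 * (real 5 - 1)) - 2 / 2 ^ 5)
        \<le> (1 + 1 / 2 ^ 3) * (1 + 1 / real 5)"
      proof (intro weight_inequality_first_column)
        fix a b assume "(a, b) \<in> exponent_pairs" "(a, b) \<notin> {}"
        then show "a = 1 \<and> 1 \<le> b \<or> a = 2 \<and> 1 \<le> b \<or> b = 0 \<and> 5 \<le> a"
          using exponent_pair_cases[of a b] no3 False by auto
      qed (use y assms(3) e3 in auto)
      then show False by simp
    qed
  qed
qed

lemma even_f_of_q3:
  assumes "q = 3"
  shows "even f"
  using q_mod_4 assms by auto

text \<open>A power of 3 plus 1 is prime to 3, so \<open>j 3 = 0\<close>; since \<open>f\<close> is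
  even only \<open>i 3 = 2\<close> remains.\<close>

lemma component_three:
  assumes "q = 3" "3 \<in> prime_factors N"
  shows "i 3 = 2" "j 3 = 0" "multiplicity 3 N = 1"
proof -
  have "3 dvd (3::nat) ^ multiplicity 3 N" using prime_factorD(4)[OF assms(2)] by (metis dvd_power)
  then have "\<not> 3 dvd 2 ^ i 3 * q ^ j 3" unfolding component[OF assms(2), symmetric] by presburger
  then show j: "j 3 = 0" using assms(1) by (cases "j 3") auto
  then show i: "i 3 = 2"
    using exponent_of_two_cases[OF assms(2)] even_f_of_q3[OF assms(1)] mersenne_exponent(1)[OF assms(2)] by simp
  then have "3 ^ multiplicity 3 N = (3::nat)" using component[OF assms(2)] j by simp
  then show "multiplicity 3 N = 1" using prime_power_eq_prime[of 3 _ 3] by simp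
qed

lemma N_eq_165_of_q3:
  assumes "N \<noteq> 9" "q = 3"
  shows "N = 165"
proof -
  note even_f = even_f_of_q3[OF assms(2)]
  then have "f \<ge> 2" using f_pos by presburger
  then have y: "9 \<le> q ^ f" using q_power_mono[of 3 2] assms(2) by simp
  note cases = exponent_pair_cases_even[OF _ even_f]
  \<comment> \<open>For even \<open>e\<close> only the column \<open>a = 1\<close> is left, and 1.5
    exceeds the right-hand side, about 1.39.\<close>
  have "odd e"
  proof
    assume "even e"
    have "2 * (\<Prod>s\<in>{}. 1 - weight s) *
        (1 - (1 / (2 * real q ^ 1) + 1 / (4 * real q ^ 20)) * (q / (real q - 1)) - 2 / 2 ^ 20)
      \<le> (1 + 1 / 2 ^ 2) * (1 + 1 / real 9)"
      using y e_ge_2[OF assms(1)] cases \<open>even e\<close> by (intro weight_inequality) auto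
    then show False using assms(2) by simp
  qed
  then obtain k where k: "e = Suc (2 * k)" by (metis oddE Suc_eq_plus1)
  then have e_eq: "2 ^ e = 2 * (4::nat) ^ k" by (simp add: power_mult)
  have "4 ^ k mod 3 = (1::nat)" by (rule power_mod_eq_1) simp
  then have "3 dvd 2 ^ e + (1::nat)" unfolding e_eq by presburger
  then have three: "3 \<in> prime_factors N"
    using prime_dvd_N_iff[of 3] N_pos by (simp add: in_prime_factors_iff)
  note c3 = component_three[OF assms(2) three]
  have S3: "(2, 0) \<in> exponent_pairs" using three c3 by (force simp: exponent_pairs_def)
  have "e \<noteq> 3"
  proof
    assume "e = 3"
    then have "2 * N = 9 * (q ^ f + 1)" using twice_N by simp
    then have "9 dvd N" by presburger
    then have "3 ^ 2 dvd N" by simp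
    then have "2 \<le> multiplicity 3 N" using N_pos by (intro multiplicity_geI) auto
    then show False using c3 by simp
  qed
  moreover have "3 \<le> e" using exponent_pair_less_e[OF assms(1) S3] by simp
  ultimately have "5 \<le> e" using \<open>odd e\<close> by presburger
  \<comment> \<open>The pair of the prime 5 = 2 * 3 - 1. Without it: about 1.188 against
    1.146.\<close>
  have S5: "(1, 1) \<in> exponent_pairs"
  proof (rule ccontr)
    assume no5: "(1, 1) \<notin> exponent_pairs"
    have "2 * (\<Prod>s\<in>{(2, 0)}. 1 - weight s) *
        (1 - (1 / (2 * real q ^ 2) + 1 / (4 * real q ^ 1)) * (q / (real q - 1)) - 2 / 2 ^ 20)
      \<le> (1 + 1 / 2 ^ 5) * (1 + 1 / real 9)"
    proof (intro weight_inequality)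
      fix a b assume ab: "(a, b) \<in> exponent_pairs" "(a, b) \<notin> {(2, 0)}"
      then show "a = 1 \<and> 2 \<le> b \<or> a = 2 \<and> 1 \<le> b \<or> b = 0 \<and> 20 \<le> a"
        using cases[OF ab(1)] no5 by (cases "b = 1") auto
    qed (use \<open>5 \<le> e\<close> y in auto)
    then show False by (simp add: assms(2) weight_eq[unfolded assms(2)])
  qed
  note c5 = pair_imp_prime[OF S5, of 5, unfolded assms(2), simplified]
  obtain l where l: "f = 2 * l" using even_f by blast
  \<comment> \<open>The prime 5 never divides \<open>2 ^ e + 1\<close> for odd \<open>e\<close>, so
    it divides \<open>3 ^ f + 1\<close>, and \<open>f\<close> is not a multiple of 4.\<close>
  have "odd l"
  proof
    assume "even l"
    then obtain l' where "f = 4 * l'" using l by auto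
    have "81 ^ l' mod 5 = (1::nat)" by (rule power_mod_eq_1) simp
    then have "3 ^ f mod 5 = (1::nat)" using \<open>f = 4 * l'\<close> by (simp add: power_mult)
    then have "\<not> 5 dvd q ^ f + 1" using assms(2) by presburger
    moreover have "\<not> 5 dvd 2 ^ e + (1::nat)" unfolding e_eq using power_4_mod_5[of k] by presburger
    ultimately show False using prime_factorD(5)[OF c5(1)] by blast
  qed
  then obtain l' where l': "l = Suc (2 * l')" by (metis oddE Suc_eq_plus1)
  \<comment> \<open>This pair stands for 17 = 2 * 9 - 1, which divides neither factor of
    \<open>2 * N\<close> for the present parities of \<open>e\<close> and \<open>l\<close>.\<close>
  have no17: "(1, 2) \<notin> exponent_pairs"
  proof
    assume "(1, 2) \<in> exponent_pairs"
    then have "17 \<in> prime_factors N" using pair_imp_prime[of 1 2 17] assms(2) by simp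
    then have "17 dvd 2 ^ e + (1::nat) \<or> 17 dvd q ^ f + 1" by (rule prime_factorD(5))
    moreover have "\<not> 17 dvd 2 ^ e + (1::nat)" unfolding e_eq using power_4_mod_17[of k] by presburger
    moreover have "q ^ f = 9 * 81 ^ l'" unfolding assms(2) l l' by (simp add: power_mult)
    moreover have "\<not> 17 dvd 9 * 81 ^ l' + (1::nat)" using power_81_mod_17[of l'] by presburger
    ultimately show False by simp
  qed
  \<comment> \<open>The pair of the prime 11 = 4 * 3 - 1. Without it: about 1.163 against
    1.146.\<close>
  have S11: "(2, 1) \<in> exponent_pairs"
  proof (rule ccontr)
    assume no11: "(2, 1) \<notin> exponent_pairs"
    have "2 * (\<Prod>s\<in>{(2, 0), (1, 1)}. 1 - weight s) *
        (1 - (1 / (2 * real q ^ 3) + 1 / (4 * real q ^ 2)) * (q / (real q - 1)) - 2 / 2 ^ 20)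
      \<le> (1 + 1 / 2 ^ 5) * (1 + 1 / real 9)"
    proof (intro weight_inequality)
      fix a b assume ab: "(a, b) \<in> exponent_pairs" "(a, b) \<notin> {(2, 0), (1, 1)}"
      then have "(a, b) \<noteq> (2, 0)" "(a, b) \<noteq> (1, 1)" "(a, b) \<noteq> (1, 2)" "(a, b) \<noteq> (2, 1)"
        using no11 no17 by auto
      then show "a = 1 \<and> 3 \<le> b \<or> a = 2 \<and> 2 \<le> b \<or> b = 0 \<and> 20 \<le> a"
        using cases[OF ab(1)] by auto
    qed (use \<open>5 \<le> e\<close> y in auto)
    then show False by (simp add: assms(2) weight_eq[unfolded assms(2)])
  qed
  note c11 = pair_imp_prime[OF S11, of 11, unfolded assms(2), simplified]
  have "f = 2"
  proof (rule ccontr)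
    assume "f \<noteq> 2"
    then have "6 \<le> f" using l \<open>odd l\<close> by presburger
    then have "729 \<le> q ^ f" using q_power_mono[of 3 6] assms(2) by simp
    \<comment> \<open>The pairs of 3, 5 and 11 alone give equality in the weight identity at
      \<open>e = 5\<close>, \<open>f = 2\<close>; with \<open>f\<close> at least 6 it is about 1.066
      against 1.033.\<close>
    have "2 * (\<Prod>s\<in>{(2, 0), (1, 1), (2, 1)}. 1 - weight s) *
        (1 - (1 / (2 * real q ^ 3) + 1 / (4 * real q ^ 2)) * (q / (real q - 1)) - 2 / 2 ^ 20)
      \<le> (1 + 1 / 2 ^ 5) * (1 + 1 / real 729)"
    proof (intro weight_inequality)
      fix a b assume ab: "(a, b) \<in> exponent_pairs" "(a, b) \<notin> {(2, 0), (1, 1), (2, 1)}"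
      then have "(a, b) \<noteq> (2, 0)" "(a, b) \<noteq> (1, 1)" "(a, b) \<noteq> (1, 2)" "(a, b) \<noteq> (2, 1)"
        using no17 by auto
      then show "a = 1 \<and> 3 \<le> b \<or> a = 2 \<and> 2 \<le> b \<or> b = 0 \<and> 20 \<le> a"
        using cases[OF ab(1)] by auto
    qed (use \<open>5 \<le> e\<close> \<open>729 \<le> q ^ f\<close> in auto)
    then show False by (simp add: assms(2) weight_eq[unfolded assms(2)])
  qed
  have sub: "{3, 5, 11} \<subseteq> prime_factors N" using three c5 c11 by auto
  have "prime_factors N \<subseteq> {3, 5, 11}"
  proof
    fix p assume p: "p \<in> prime_factors N"
    show "p \<in> {3, 5, 11}"
    proof (rule ccontr)
      assume "p \<notin> {3, 5, 11}"
      \<comment> \<open>The primes 5 and 11 use up \<open>f = 2\<close>, so a further prime would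
        share the pair (2, 0) with 3.\<close>
      then have "(\<Sum>p\<in>{3, 5, 11, p}. j p) = 2 + j p" using c3 c5 c11 by simp
      moreover have "(\<Sum>p\<in>{3, 5, 11, p}. j p) \<le> (\<Sum>p\<in>prime_factors N. j p)"
        using sub p by (intro sum_mono2) auto
      ultimately have "j p = 0" using sum_j \<open>f = 2\<close> by simp
      moreover have "i p = 2"
        using exponent_of_two_cases[OF p] even_f mersenne_exponent(1)[OF p \<open>j p = 0\<close>] by auto
      ultimately have "(i p, j p) = (i 3, j 3)" using c3 by simp
      then have "p = 3" using inj_onD[OF inj_exponents _ p three] by blast
      then show False using \<open>p \<notin> {3, 5, 11}\<close> by simp
    qed
  qed
  then have "prime_factors N = {3, 5, 11}" using sub by blast
  then show ?thesis using prime_factorization_nat[OF N_pos] c3 c5 c11 by simp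
qed

lemma N_eq_9_or_165: "N = 9 \<or> N = 165"
proof (cases "N = 9")
  case False
  consider "q = 3" | "even f" "q \<ge> 5" | "odd f" "q = 5" | "odd f" "q \<ge> 13"
  proof -
    have "q mod 4 = 1" if "odd f" using that by (rule q_mod_4)
    moreover have "q \<noteq> 9" using prime_q by auto
    moreover have "q = 3 \<or> q \<ge> 5" using q_ge_3 odd_q by presburger
    moreover have "q = 5 \<or> q \<ge> 13" if "q mod 4 = 1" "q \<noteq> 9" "q \<ge> 5"
      using that by presburger
    ultimately show ?thesis using that by blast
  qed
  then show ?thesis
    using N_eq_165_of_q3 no_solution_even_f no_solution_odd_f_q5 no_solution_odd_f_large_q False
    by cases blast+
qed simp

end

theorem theorem1p1:
  fixes N :: nat
  assumes "N > 0" and "odd N"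
    and "unitary_sigma (unitary_sigma N) = 2 * N"
  shows "N = 9 \<or> N = 165"
proof -
  obtain q e f i j where "odd_usp N q e f i j"
    using odd_usp_structure[OF assms] assms(1,2) unfolding odd_usp_def by metis
  then show ?thesis by (rule odd_usp.N_eq_9_or_165)
qed

end
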